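(* Let $m\in\{2,3,\dots\}$, $k\in\{1,\dots,m\}$ and $g=(g_1,\dots,g_m)\sim\mathcal{N}(0,I_m)$. Then $$ \mathbb{P}\left[\max_{1\le l\le k}g_l\le\frac1m\sum_{j=1}^mg_j\le\min_{k+1\le r\le m}g_r\right]=\mathbb{E}\left[\Phi\left(\frac{ig_1}{\sqrt m}\right)^k\Phi\left(\frac{-ig_1}{\sqrt m}\right)^{m-k}\right]. $$
   Context: $i:=\sqrt{-1}$ and $\Phi:\mathbb{C}\to\mathbb{C}$, $\Phi(z):=\frac12+\frac{1}{\sqrt{2\pi}}\int_0^ze^{-t^2/2}\,dt$. For $k=m$ the minimum over the empty set is $+\infty$. *)

theory Defs
  imports "HOL-Probability.Probability" "HOL-Complex_Analysis.Complex_Analysis"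
begin

(* The integral from 0 to z is taken along the straight segment; the integrand is entire,
   so the choice of path does not matter. *)
definition Phi :: "complex \<Rightarrow> complex" where
  "Phi z = 1 / 2 + 1 / complex_of_real (sqrt (2 * pi)) *
     contour_integral (linepath 0 z) (\<lambda>t. exp (- t\<^sup>2 / 2))"

(* The standard normal law N(0, I_m) of a random vector (g 1, ..., g m): the coordinates are
   independent and each has law N(0, 1). *)
definition std_normal_vector :: "'a measure \<Rightarrow> nat \<Rightarrow> (nat \<Rightarrow> 'a \<Rightarrow> real) \<Rightarrow> bool" where
  "std_normal_vector M m g \<longleftrightarrow>
     prob_space.indep_vars M (\<lambda>_. borel) g {1..m} \<and>
     (\<forall>j\<in>{1..m}. distributed M lborel (g j) (\<lambda>x. ennreal (std_normal_density x)))"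

end

theory Submission
  imports Defs
begin

text \<open>
  Let $K(w) = E[1_{\xi \le 0} e^{-iw\xi}]$ for $\xi \sim N(0,1)$. Shifting the line of integration in
  $\Phi$ gives $\Phi(iw) = e^{w^2/2} K(w)$, so the Gaussian factors cancel and, up to a constant, the
  right-hand side is the integral over $w$ of $K(w)^k K(-w)^{m-k} = E[1_O(g) e^{-iwS}]$, where
  $S = g_1 + \dots + g_m$ and $O$ is the orthant given by the signs. This is the Fourier transform of the
  density of $S$ restricted to the event $g \in O$. Fourier inversion at 0 yields the value of that density
  at $S = 0$, and since $S$ is independent of $g - S/m$, this is $(2 \pi m)^{-1/2} P(g - S/m \in O)$.
  Inversion is legitimate because $K(w) = O(1/|w|)$ and $m \ge 2$.
\<close>

subsection \<open>The function $\Phi$ on the imaginary axis\<close>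

text \<open>Integrability of the right-hand side is itself an issue: on the imaginary axis
  \<open>Phi\<close> grows like exp(w^2 / 2) / |w|. At w = g_1 / sqrt m the m factors contribute
  exactly exp(g_1^2 / 2), the reciprocal of the Gaussian weight, so only a factor 1 / |w| per
  \<open>Phi\<close> is left. This rate is sharp, because the half-line density jumps at 0; one
  factor alone would not be integrable, two are. Inversion must give the value at one point, so the
  density of S on the event has to be explicit near 0: it is the N(0, m) density at s times the
  probability that the deviations, shifted by s / m, lie in O. It is continuous at 0 because almost
  surely no deviation vanishes. Since the deviations sum to 0, they have no density in m dimensions;
  the coordinates used are S and m - 1 of them. The constants cancel: 1 / sqrt (2 pi) from the law
  of g_1, sqrt m from w = u / sqrt m, 2 pi from inversion, 1 / sqrt (2 pi m) from the density of S
  at 0.\<close>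

lemma integral_std_normal_lower_half:
  "(LBINT t. indicator {..0} t * std_normal_density t) = 1 / 2"
proof -
  let ?f = "std_normal_density"
  have int: "integrable lborel (\<lambda>t. indicator A t * ?f t)" if "A \<in> sets borel" for A
    using integrable_real_mult_indicator[of A lborel ?f] that
    by (simp add: integrable_normal_density mult.commute)
  have "(LBINT t. indicator {..0} t * ?f t) = (LBINT t. indicator {0..} t * ?f t)"
    by (subst lborel_integral_real_affine[where c="-1" and t=0])
       (auto simp: indicator_def std_normal_density_def intro!: Bochner_Integration.integral_cong)
  moreover have "(LBINT t. indicator {..0} t * ?f t) + (LBINT t. indicator {0..} t * ?f t) = 
      (LBINT t. indicator {..0} t * ?f t + indicator {0..} t * ?f t)"
    by (rule Bochner_Integration.integral_add[symmetric]) (auto intro: int)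
  moreover have "\<dots> = (LBINT t. ?f t)"
    by (rule integral_cong_AE)
       (auto simp: indicator_def intro: AE_mp[OF AE_lborel_singleton[of 0]])
  ultimately show ?thesis by (simp add: integral_normal_density)
qed

text \<open>The K of the overview. Up to scaling it is the Faddeeva function W(z) = exp(-z^2)
  erfc(-i z): K(w) = W(w / sqrt 2) / 2.\<close>

definition half_char :: "real \<Rightarrow> complex" where
  "half_char w = (CLBINT t. indicator {..0} t *\<^sub>R (std_normal_density t *\<^sub>R iexp (- w * t)))"

lemma integrable_std_normal_iexp:
  assumes "A \<in> sets borel"
  shows "integrable lborel (\<lambda>t. indicator A t *\<^sub>R (std_normal_density t *\<^sub>R iexp (w * t)))"
proof (rule Bochner_Integration.integrable_bound)
  show "integrable lborel std_normal_density" by (simp add: integrable_normal_density)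
qed (use assms in \<open>auto simp: indicator_def\<close>)

text \<open>The shift of the line needs no rectangle contour. With a primitive \<open>F\<close> of
  the integrand, D(t) = F(t + i w) - F(t) has as derivative the difference of the integrands on the
  two horizontal lines, vanishes at minus infinity, and D(0) is the integral in \<open>Phi\<close>.
  Integrating the derivative over the negative half-line gives a multiple of
  \<open>half_char\<close> minus sqrt (2 pi) / 2, and the latter cancels the 1 / 2 in
  \<open>Phi\<close>.\<close>

lemma Phi_imaginary:
  "Phi (\<i> * of_real w) = of_real (exp (w\<^sup>2 / 2)) * half_char w"
proof -
  define f :: "complex \<Rightarrow> complex" where "f z = exp (- z\<^sup>2 / 2)" for z
  have "f holomorphic_on UNIV" unfolding f_def by (intro holomorphic_intros) auto
  then obtain F where F: "\<And>z. (F has_field_derivative f z) (at z)"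
    using holomorphic_convex_primitive'[of UNIV f] by auto
  have norm_f: "norm (f z) = exp ((Im z)\<^sup>2 / 2) * exp (- (Re z)\<^sup>2 / 2)" for z
    by (simp add: f_def power2_eq_square flip: exp_add) (simp add: field_simps)
  have f_shift: "f (of_real t + \<i> * of_real w) =
      (exp (w\<^sup>2 / 2) * sqrt (2 * pi)) *\<^sub>R (std_normal_density t *\<^sub>R iexp (- w * t))" for t
    by (simp add: f_def std_normal_density_def scaleR_conv_of_real exp_of_real[symmetric] 
           power2_eq_square algebra_simps add_divide_distrib diff_divide_distrib exp_add[symmetric] exp_diff[symmetric])
  define D where "D t = F (of_real t + \<i> * of_real w) - F (of_real t)" for t :: real
  define d where "d t = f (of_real t + \<i> * of_real w) - f (of_real t)" for t :: real
  have d_eq: "d t = (exp (w\<^sup>2 / 2) * sqrt (2 * pi)) *\<^sub>R (std_normal_density t *\<^sub>R iexp (- w * t))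
      - sqrt (2 * pi) *\<^sub>R of_real (std_normal_density t)" for t
    unfolding d_def f_shift
    by (simp add: f_def std_normal_density_def scaleR_conv_of_real exp_of_real[symmetric])
  have D: "(D has_vector_derivative d t) (at t)" for t
  proof -
    have 1: "((\<lambda>t. of_real t + \<i> * of_real w) has_vector_derivative 1) (at t)"
      by (auto intro!: derivative_eq_intros)
    have 2: "((\<lambda>t. of_real t :: complex) has_vector_derivative 1) (at t)"
      by (auto intro!: derivative_eq_intros)
    show ?thesis unfolding D_def[abs_def] d_def
      using has_vector_derivative_diff[OF field_vector_diff_chain_at[OF 1 F] field_vector_diff_chain_at[OF 2 F]]
      by (simp add: o_def)
  qed
  have D_bound: "norm (D t) \<le> exp (w\<^sup>2 / 2) * exp (- t\<^sup>2 / 2) * \<bar>w\<bar>" for t :: real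
  proof -
    \<comment> \<open>A vertical segment containing both end points, taken symmetric about the real
      axis so that the sign of w does not matter. On it the integrand is at most exp(w^2 / 2)
      exp(-t^2 / 2), and the mean value inequality applies.\<close>
    let ?S = "{z. Re z = t \<and> \<bar>Im z\<bar> \<le> \<bar>w\<bar>}"
    have "norm (F (of_real t + \<i> * of_real w) - F (of_real t)) \<le>
       (exp (w\<^sup>2 / 2) * exp (- t\<^sup>2 / 2)) * norm ((of_real t + \<i> * of_real w) - of_real t)"
    proof (rule field_differentiable_bound[of ?S F f])
      have "?S = ({z. Re z \<le> t} \<inter> {z. Re z \<ge> t}) \<inter> ({z. Im z \<le> \<bar>w\<bar>} \<inter> {z. Im z \<ge> - \<bar>w\<bar>})" by auto
      also have "convex \<dots>"
        by (intro convex_Int convex_halfspace_Im_le convex_halfspace_Im_ge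
              convex_halfspace_Re_le convex_halfspace_Re_ge)
      finally show "convex ?S" .
      show "norm (f z) \<le> exp (w\<^sup>2 / 2) * exp (- t\<^sup>2 / 2)" if "z \<in> ?S" for z
        using that by (auto simp: norm_f abs_le_square_iff)
    qed (auto intro: has_field_derivative_at_within F)
    then show ?thesis by (simp add: D_def norm_mult)
  qed
  have lim: "(D \<longlongrightarrow> 0) at_bot"
  proof (rule Lim_null_comparison)
    show "\<forall>\<^sub>F t in at_bot. norm (D t) \<le> exp (w\<^sup>2 / 2) * exp (- t\<^sup>2 / 2) * \<bar>w\<bar>"
      using D_bound by (intro always_eventually) auto
    have "((\<lambda>t::real. exp (- t\<^sup>2 / 2)) \<longlongrightarrow> 0) at_bot"
      by (rule filterlim_compose[OF exp_at_bot]) real_asymp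
    then have "((\<lambda>t::real. exp (w\<^sup>2 / 2) * exp (- t\<^sup>2 / 2) * \<bar>w\<bar>) \<longlongrightarrow> exp (w\<^sup>2 / 2) * 0 * \<bar>w\<bar>) at_bot"
      by (intro tendsto_intros)
    then show "((\<lambda>t::real. exp (w\<^sup>2 / 2) * exp (- t\<^sup>2 / 2) * \<bar>w\<bar>) \<longlongrightarrow> 0) at_bot" by simp
  qed
  have d_cont: "isCont d t" for t
    unfolding d_def[abs_def] f_def by (intro continuous_intros) auto
  have int1: "integrable lborel (\<lambda>t. indicator {..0} t *\<^sub>R (std_normal_density t *\<^sub>R iexp (- w * t)))"
    by (intro integrable_std_normal_iexp) auto
  have int2: "integrable lborel (\<lambda>t. of_real (indicator {..0} t * std_normal_density t) :: complex)"
    using integrable_real_mult_indicator[of "{..0}" lborel std_normal_density]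
    by (intro integrable_of_real) (simp add: integrable_normal_density mult.commute)
  have d_ind: "indicator {..0} t *\<^sub>R d t =
     (exp (w\<^sup>2 / 2) * sqrt (2 * pi)) *\<^sub>R (indicator {..0} t *\<^sub>R (std_normal_density t *\<^sub>R iexp (- w * t)))
     - sqrt (2 * pi) *\<^sub>R of_real (indicator {..0} t * std_normal_density t)" for t
    unfolding d_eq by (simp add: indicator_def)
  have d_int: "integrable lborel (\<lambda>t. indicator {..0} t *\<^sub>R d t)"
    unfolding d_ind using int1 int2 by (intro Bochner_Integration.integrable_diff integrable_scaleR_right) auto
  have ei: "einterval (-\<infinity>) 0 = {..<0}" by (auto simp: einterval_def)
  have d_int': "integrable lborel (\<lambda>t. indicator {..<0} t *\<^sub>R d t)"
    unfolding set_integrable_def[symmetric]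
    by (rule set_integrable_subset[of lborel "{..0}"]) (use d_int in \<open>auto simp: set_integrable_def\<close>)
  have "(LBINT t=-\<infinity>..0. d t) = D 0 - 0"
  proof (rule interval_integral_FTC_integrable)
    show "set_integrable lborel (einterval (-\<infinity>) 0) d"
      using d_int' by (simp add: ei set_integrable_def)
    show "((D \<circ> real_of_ereal) \<longlongrightarrow> 0) (at_right (-\<infinity>))"
      using lim by (simp add: ereal_tendsto_simps)
    have "isCont D 0" using D[of 0] has_vector_derivative_continuous by blast
    then have "(D \<longlongrightarrow> D 0) (at_left 0)"
      by (auto simp: isCont_def intro: filterlim_at_split[THEN iffD1, THEN conjunct1])
    then show "((D \<circ> real_of_ereal) \<longlongrightarrow> D 0) (at_left 0)"
      unfolding zero_ereal_def by (simp add: ereal_tendsto_simps)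
  qed (auto intro: D d_cont)
  also have "(LBINT t=-\<infinity>..0. d t) = (LBINT t. indicator {..0} t *\<^sub>R d t)"
    unfolding interval_lebesgue_integral_def ei set_lebesgue_integral_def
    using d_int d_int'
    by (auto intro!: integral_cong_AE intro: AE_mp[OF AE_lborel_singleton[of 0]] simp: indicator_def)
  also have "\<dots> = (exp (w\<^sup>2 / 2) * sqrt (2 * pi)) *\<^sub>R half_char w - sqrt (2 * pi) *\<^sub>R of_real (1 / 2)"
    unfolding d_ind half_char_def
    by (subst Bochner_Integration.integral_diff)
       (use int1 int2 in \<open>simp_all only: integral_scaleR_right integrable_scaleR_right
          integral_complex_of_real integral_std_normal_lower_half simp_thms\<close>)
  finally have eq: "D 0 = (exp (w\<^sup>2 / 2) * sqrt (2 * pi)) *\<^sub>R half_char w - sqrt (2 * pi) *\<^sub>R of_real (1 / 2)"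
    by simp
  have "(f has_contour_integral (F (\<i> * of_real w) - F 0)) (linepath 0 (\<i> * of_real w))"
    using contour_integral_primitive[of UNIV F f "linepath 0 (\<i> * of_real w)"] F by simp
  then have "contour_integral (linepath 0 (\<i> * of_real w)) f = D 0"
    by (simp add: D_def contour_integral_unique)
  then show ?thesis
    unfolding Phi_def f_def[symmetric, abs_def] eq
    by (simp add: scaleR_conv_of_real field_simps)
qed

section \<open>Bounds and integrability for the half-line transform\<close>

lemma norm_half_char_le_1: "norm (half_char w) \<le> 1"
proof -
  have "norm (half_char w) \<le> (LBINT t. norm (indicator {..0} t *\<^sub>R (std_normal_density t *\<^sub>R iexp (- w * t))))"
    unfolding half_char_def by (rule integral_norm_bound)
  also have "\<dots> = (LBINT t. indicator {..0} t * std_normal_density t)"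
    by (simp add: norm_mult)
  also have "\<dots> \<le> 1" by (simp add: integral_std_normal_lower_half)
  finally show ?thesis .
qed

text \<open>The bound is read off from \<open>Phi\<close>. On the segment from 0 to i w the
  integrand at parameter x is exp(x^2 w^2 / 2), and x^2 \<le> x replaces this by exp(x w^2 / 2),
  which has an elementary primitive. The segment integral is thus at most exp(w^2 / 2) times 2 /
  |w|, and division by exp(w^2 / 2) leaves the decay.\<close>

lemma half_char_decay: "\<bar>w\<bar> * norm (half_char w) \<le> 2"
proof (cases "w = 0")
  case False
  define f :: "complex \<Rightarrow> complex" where "f z = exp (- z\<^sup>2 / 2)" for z
  have f_hol: "f holomorphic_on UNIV" unfolding f_def by (intro holomorphic_intros) auto
  have "f contour_integrable_on linepath 0 (\<i> * of_real w)"
    by (intro contour_integrable_continuous_linepath holomorphic_on_imp_continuous_on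
          holomorphic_on_subset[OF f_hol]) auto
  then have "(f has_contour_integral contour_integral (linepath 0 (\<i> * of_real w)) f) (linepath 0 (\<i> * of_real w))"
    by (rule has_contour_integral_integral)
  then have 1: "((\<lambda>x. f (linepath 0 (\<i> * of_real w) x) * (\<i> * of_real w)) has_integral
      contour_integral (linepath 0 (\<i> * of_real w)) f) {0..1}"
    by (simp add: has_contour_integral_linepath)
  have 2: "((\<lambda>x. exp (w\<^sup>2 / 2 * x) * \<bar>w\<bar>) has_integral
      (exp (w\<^sup>2 / 2 * 1) * (2 / \<bar>w\<bar>) - exp (w\<^sup>2 / 2 * 0) * (2 / \<bar>w\<bar>))) {0..1}"
    using False
    by (intro fundamental_theorem_of_calculus)
       (auto intro!: derivative_eq_intros simp: has_real_derivative_iff_has_vector_derivative[symmetric] 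
           field_simps power2_eq_square abs_if)
  have "norm (contour_integral (linepath 0 (\<i> * of_real w)) f) \<le> 
     exp (w\<^sup>2 / 2 * 1) * (2 / \<bar>w\<bar>) - exp (w\<^sup>2 / 2 * 0) * (2 / \<bar>w\<bar>)"
    unfolding integral_unique[OF 1, symmetric] integral_unique[OF 2, symmetric]
  proof (rule integral_norm_bound_integral)
    fix x :: real assume "x \<in> {0..1}"
    then have "x\<^sup>2 * w\<^sup>2 \<le> x * w\<^sup>2"
      by (intro mult_right_mono) (auto simp: power2_eq_square mult_left_le)
    then show "norm (f (linepath 0 (\<i> * of_real w) x) * (\<i> * of_real w)) \<le> exp (w\<^sup>2 / 2 * x) * \<bar>w\<bar>"
      by (auto simp: norm_mult f_def linepath_def scaleR_conv_of_real power_mult_distrib mult.commute[of "w\<^sup>2"] intro!: mult_right_mono)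
  qed (use 1 2 in auto)
  also have "\<dots> \<le> exp (w\<^sup>2 / 2) * (2 / \<bar>w\<bar>)" by simp
  finally have ci: "norm (contour_integral (linepath 0 (\<i> * of_real w)) f) \<le> exp (w\<^sup>2 / 2) * (2 / \<bar>w\<bar>)" .
  have "exp (w\<^sup>2 / 2) * norm (half_char w) = norm (Phi (\<i> * of_real w))"
    by (simp add: Phi_imaginary norm_mult)
  also have "\<dots> \<le> 1 / 2 + 1 / sqrt (2 * pi) * norm (contour_integral (linepath 0 (\<i> * of_real w)) f)"
    unfolding Phi_def f_def[symmetric, abs_def]
    by (rule norm_triangle_le) (simp add: norm_mult norm_divide)
  \<comment> \<open>Rounding sqrt (2 pi) down to 2 makes the second term, multiplied by |w|, equal
    to exp(w^2 / 2). The first becomes |w| / 2, which is also at most exp(w^2 / 2); hence the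
    constant 2.\<close>
  also have "\<dots> \<le> 1 / 2 + 1 / 2 * (exp (w\<^sup>2 / 2) * (2 / \<bar>w\<bar>))"
  proof (intro add_left_mono mult_mono ci)
    have "sqrt (2\<^sup>2) \<le> sqrt (2 * pi)" using pi_gt3 by (intro real_sqrt_le_mono) auto
    then show "1 / sqrt (2 * pi) \<le> 1 / 2" by (simp add: field_simps)
  qed auto
  finally have "\<bar>w\<bar> * (exp (w\<^sup>2 / 2) * norm (half_char w)) \<le> \<bar>w\<bar> * (1 / 2 + 1 / 2 * (exp (w\<^sup>2 / 2) * (2 / \<bar>w\<bar>)))"
    by (intro mult_left_mono) auto
  also have "\<dots> = \<bar>w\<bar> / 2 + exp (w\<^sup>2 / 2)" using False by (simp add: field_simps)
  also have "\<bar>w\<bar> / 2 \<le> exp (w\<^sup>2 / 2)"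
  proof -
    have "0 \<le> (\<bar>w\<bar> - 1)\<^sup>2" by simp
    then have "\<bar>w\<bar> \<le> 1 + w\<^sup>2 / 2" by (simp add: power2_eq_square algebra_simps)
    also have "\<dots> \<le> exp (w\<^sup>2 / 2)" by (rule exp_ge_add_one_self)
    finally show ?thesis by simp
  qed
  finally have "exp (w\<^sup>2 / 2) * (\<bar>w\<bar> * norm (half_char w)) \<le> exp (w\<^sup>2 / 2) * 2"
    by (simp add: algebra_simps)
  then show ?thesis by simp
qed auto

text \<open>Reflection t to -t turns the sign of w into the choice of the half-line. Both kinds of
  factor then carry the same kernel exp(-i w t), so that their product can become a transform of the
  coordinate sum.\<close>

lemma half_char_std_normal_distribution:
  "half_char w = (LINT t|std_normal_distribution. indicator {..0} t *\<^sub>R iexp (- w * t))"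
  "half_char (- w) = (LINT t|std_normal_distribution. indicator {0..} t *\<^sub>R iexp (- w * t))"
proof -
  show "half_char w = (LINT t|std_normal_distribution. indicator {..0} t *\<^sub>R iexp (- w * t))"
    unfolding half_char_def by (subst integral_density) (auto simp: mult.commute)
  have "half_char (- w) = (CLBINT t. indicator {0..} t *\<^sub>R (std_normal_density t *\<^sub>R iexp (- w * t)))"
    unfolding half_char_def
    by (subst lborel_integral_real_affine[where c="-1" and t=0])
       (auto simp: indicator_def std_normal_density_def intro!: Bochner_Integration.integral_cong)
  then show "half_char (- w) = (LINT t|std_normal_distribution. indicator {0..} t *\<^sub>R iexp (- w * t))"
    by (subst integral_density) (auto simp: mult.commute)
qed

lemma borel_measurable_half_char [measurable]: "half_char \<in> borel_measurable borel"
  unfolding half_char_def[abs_def] by measurable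

lemma integrable_half_char_power:
  assumes "k + l \<ge> 2"
  shows "integrable lborel (\<lambda>w. half_char w ^ k * half_char (- w) ^ l)"
proof (rule Bochner_Integration.integrable_bound[of _ "\<lambda>w::real. 8 * inverse (1 + w\<^sup>2)"])
  have "einterval (-\<infinity>) \<infinity> = UNIV" by (auto simp: einterval_def)
  then show "integrable lborel (\<lambda>w::real. 8 * inverse (1 + w\<^sup>2))"
    using integrable_inverse_1_plus_square by (simp add: set_integrable_def)
  have "norm (half_char w ^ k * half_char (- w) ^ l) \<le> 8 * inverse (1 + w\<^sup>2)" for w
  proof -
    \<comment> \<open>The minimum of the bounds 1 and 2 / |w|; being even in w, it serves both kinds
      of factor.\<close>
    define b where "b = 2 / max 2 \<bar>w\<bar>"
    have b: "0 \<le> b" "b \<le> 1" by (auto simp: b_def)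
    have hb: "norm (half_char v) \<le> b" if "\<bar>v\<bar> = \<bar>w\<bar>" for v
      using norm_half_char_le_1[of v] half_char_decay[of v] that
      by (auto simp: b_def max_def field_simps)
    have "norm (half_char w ^ k * half_char (- w) ^ l) \<le> b ^ k * b ^ l"
      unfolding norm_mult norm_power using b
      by (intro mult_mono power_mono hb) auto
    also have "\<dots> = b ^ (k + l)" by (simp add: power_add)
    also have "\<dots> \<le> b\<^sup>2" using b assms by (intro power_decreasing) auto
    \<comment> \<open>For |w| \<le> 2 the left side is 1 and 1 + w^2 is at most 5; otherwise b^2 w^2
      = 4 and b^2 \<le> 1. The constant 8 covers both cases.\<close>
    also have "\<dots> \<le> 8 * inverse (1 + w\<^sup>2)"
    proof (cases "\<bar>w\<bar> \<le> 2")
      case True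
      then have "w\<^sup>2 \<le> 4" using power_mono[of "\<bar>w\<bar>" 2 2] by simp
      moreover have "b = 1" using True by (simp add: b_def)
      moreover have "1 + w\<^sup>2 > 0" by (simp add: add_pos_nonneg)
      ultimately show ?thesis by (simp add: field_simps)
    next
      case False
      then have "b\<^sup>2 * w\<^sup>2 = 4" by (auto simp: b_def max_def power_divide)
      moreover have "b\<^sup>2 \<le> 1" using b by (simp add: power_le_one)
      ultimately have "b\<^sup>2 * (1 + w\<^sup>2) \<le> 8" by (simp add: distrib_left)
      moreover have "1 + w\<^sup>2 > 0" by (simp add: add_pos_nonneg)
      ultimately show ?thesis by (simp add: field_simps)
    qed
    finally show ?thesis .
  qed
  then show "AE w in lborel. norm (half_char w ^ k * half_char (- w) ^ l) \<le> norm (8 * inverse (1 + w\<^sup>2))"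
    by (auto simp: abs_inverse intro: order.trans[OF _ abs_ge_self])
qed measurable

subsection \<open>Sum and deviations of a standard normal vector\<close>

text \<open>Passes to Lebesgue measure, where coordinates can be changed. Both sides agree on boxes,
  which determine a finite product measure.\<close>

lemma PiM_std_normal_distribution:
  assumes "finite I"
  shows "PiM I (\<lambda>_. std_normal_distribution) =
    density (PiM I (\<lambda>_. lborel)) (\<lambda>x. \<Prod>i\<in>I. ennreal (std_normal_density (x i)))"
proof (rule product_sigma_finite.PiM_eqI[symmetric])
  interpret N: prob_space std_normal_distribution by (rule prob_space_normal_density) auto
  show "product_sigma_finite (\<lambda>_. std_normal_distribution)" by standard (rule N.sigma_finite_countable)
  interpret L: product_sigma_finite "\<lambda>_. lborel :: real measure" ..
  show "finite I" by fact
  show "sets (density (PiM I (\<lambda>_. lborel)) (\<lambda>x. \<Prod>i\<in>I. ennreal (std_normal_density (x i)))) =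
      sets (PiM I (\<lambda>_. std_normal_distribution))"
    unfolding sets_density by (intro sets_PiM_cong) auto
  fix A :: "'a \<Rightarrow> real set" assume A: "\<And>i. i \<in> I \<Longrightarrow> A i \<in> sets std_normal_distribution"
  have [measurable]: "Pi\<^sub>E I A \<in> sets (PiM I (\<lambda>_. lborel))"
    using A assms by (intro sets_PiM_I_finite) auto
  have "emeasure (density (PiM I (\<lambda>_. lborel)) (\<lambda>x. \<Prod>i\<in>I. ennreal (std_normal_density (x i)))) (Pi\<^sub>E I A)
     = (\<integral>\<^sup>+ x. (\<Prod>i\<in>I. ennreal (std_normal_density (x i))) * indicator (Pi\<^sub>E I A) x \<partial>PiM I (\<lambda>_. lborel))"
    by (intro emeasure_density) auto
  also have "\<dots> = (\<integral>\<^sup>+ x. (\<Prod>i\<in>I. ennreal (std_normal_density (x i)) * indicator (A i) (x i)) \<partial>PiM I (\<lambda>_. lborel))"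
  proof (intro nn_integral_cong)
    fix x assume "x \<in> space (PiM I (\<lambda>_. lborel :: real measure))"
    then have "x \<in> extensional I" by (auto simp: space_PiM PiE_def)
    then have "(\<Prod>i\<in>I. indicator (A i) (x i)) = (indicator (Pi\<^sub>E I A) x :: ennreal)"
      using assms by (cases "x \<in> Pi\<^sub>E I A") (auto simp: PiE_def Pi_def indicator_def)
    then show "(\<Prod>i\<in>I. ennreal (std_normal_density (x i))) * indicator (Pi\<^sub>E I A) x =
        (\<Prod>i\<in>I. ennreal (std_normal_density (x i)) * indicator (A i) (x i))"
      by (simp add: prod.distrib)
  qed
  also have "\<dots> = (\<Prod>i\<in>I. \<integral>\<^sup>+ x. ennreal (std_normal_density x) * indicator (A i) x \<partial>lborel)"
    using A assms by (intro L.product_nn_integral_prod) auto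
  also have "\<dots> = (\<Prod>i\<in>I. emeasure std_normal_distribution (A i))"
    using A by (intro prod.cong refl emeasure_density[symmetric]) auto
  finally show "emeasure (density (PiM I (\<lambda>_. lborel)) (\<lambda>x. \<Prod>i\<in>I. ennreal (std_normal_density (x i)))) (Pi\<^sub>E I A)
     = (\<Prod>i\<in>I. emeasure std_normal_distribution (A i))" .
qed

lemma nn_integral_PiM_lborel_translate:
  fixes c :: "'i \<Rightarrow> real"
  assumes "finite I" and f[measurable]: "f \<in> borel_measurable (PiM I (\<lambda>_. lborel))"
  shows "(\<integral>\<^sup>+ x. f (\<lambda>i\<in>I. x i + c i) \<partial>PiM I (\<lambda>_. lborel)) = (\<integral>\<^sup>+ x. f x \<partial>PiM I (\<lambda>_. lborel))"
proof -
  interpret L: product_sigma_finite "\<lambda>_. lborel :: real measure" ..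
  let ?T = "\<lambda>x. \<lambda>i\<in>I. x i + c i"
  let ?P = "PiM I (\<lambda>_. lborel :: real measure)"
  have [measurable]: "?T \<in> ?P \<rightarrow>\<^sub>M ?P" by measurable
  have "distr ?P ?P ?T = ?P"
  proof (rule L.PiM_eqI)
    fix A :: "'i \<Rightarrow> real set" assume A: "\<And>i. i \<in> I \<Longrightarrow> A i \<in> sets lborel"
    have [measurable]: "Pi\<^sub>E I A \<in> sets ?P"
      using A assms by (intro sets_PiM_I_finite) auto
    have "emeasure (distr ?P ?P ?T) (Pi\<^sub>E I A) = emeasure ?P (?T -` Pi\<^sub>E I A \<inter> space ?P)"
      by (rule emeasure_distr) auto
    also have "?T -` Pi\<^sub>E I A \<inter> space ?P = Pi\<^sub>E I (\<lambda>i. (\<lambda>x. x + c i) -` A i)"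
      by (auto simp: space_PiM PiE_def Pi_def)
    also have "emeasure ?P \<dots> = (\<Prod>i\<in>I. emeasure lborel ((\<lambda>x. x + c i) -` A i))"
      using A assms(1) by (intro L.emeasure_PiM) (auto intro!: measurable_sets_borel[of _ borel])
    also have "\<dots> = (\<Prod>i\<in>I. emeasure lborel (A i))"
    proof (intro prod.cong refl)
      fix i assume "i \<in> I"
      then have [measurable]: "A i \<in> sets borel" using A by auto
      have "emeasure lborel (A i) = emeasure (distr lborel borel ((+) (c i))) (A i)"
        by (simp add: lborel_distr_plus)
      also have "\<dots> = emeasure lborel ((\<lambda>x. x + c i) -` A i)"
        by (subst emeasure_distr) (simp_all add: vimage_def add.commute)
      finally show "emeasure lborel ((\<lambda>x. x + c i) -` A i) = emeasure lborel (A i)" ..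
    qed
    finally show "emeasure (distr ?P ?P ?T) (Pi\<^sub>E I A) = (\<Prod>i\<in>I. emeasure lborel (A i))" .
  qed (use assms in auto)
  then have "(\<integral>\<^sup>+ x. f x \<partial>?P) = (\<integral>\<^sup>+ x. f x \<partial>distr ?P ?P ?T)" by simp
  also have "\<dots> = (\<integral>\<^sup>+ x. f (?T x) \<partial>?P)" by (rule nn_integral_distr) auto
  finally show ?thesis ..
qed

text \<open>Unimodular change of coordinates: $s$ is the sum of all coordinates and $t$ collects the
  deviations from the mean $s/n$ of the coordinates in $I$; the deviation of coordinate $i$ is then forced.\<close>

lemma nn_integral_PiM_lborel_insert_sum:
  fixes f :: "('i \<Rightarrow> real) \<Rightarrow> ennreal"
  assumes I: "finite I" "i \<notin> I"
    and f[measurable]: "f \<in> borel_measurable (PiM (insert i I) (\<lambda>_. lborel))"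
  defines "y \<equiv> \<lambda>t. t(i := - sum t I)"
  shows "(\<integral>\<^sup>+ x. f x \<partial>PiM (insert i I) (\<lambda>_. lborel)) =
    (\<integral>\<^sup>+ s. (\<integral>\<^sup>+ t. f (\<lambda>j\<in>insert i I. y t j + s / card (insert i I)) \<partial>PiM I (\<lambda>_. lborel)) \<partial>lborel)"
proof -
  interpret L: product_sigma_finite "\<lambda>_. lborel :: real measure" ..
  let ?P = "PiM I (\<lambda>_. lborel :: real measure)"
  interpret P: sigma_finite_measure ?P by (rule L.sigma_finite) fact
  interpret PL: pair_sigma_finite ?P lborel ..
  define n :: real where "n = card (insert i I)"
  have n: "n \<ge> 1" using I by (simp add: n_def)
  have cI: "real (card I) = n - 1" using I by (simp add: n_def)
  have upd[measurable]: "(\<lambda>(x, s). x(i := s - sum x I)) \<in> ?P \<Otimes>\<^sub>M lborel \<rightarrow>\<^sub>M PiM (insert i I) (\<lambda>_. lborel)"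
    unfolding split_beta
    by (intro measurable_fun_upd[where J=I]) (auto intro!: borel_measurable_diff borel_measurable_sum)
  have "(\<integral>\<^sup>+ x. f x \<partial>PiM (insert i I) (\<lambda>_. lborel)) = (\<integral>\<^sup>+ x. (\<integral>\<^sup>+ u. f (x(i := u)) \<partial>lborel) \<partial>?P)"
    using I by (intro L.product_nn_integral_insert) auto
  \<comment> \<open>For fixed remaining coordinates the last one is replaced by the total s, a
    translation with Jacobian 1.\<close>
  also have "\<dots> = (\<integral>\<^sup>+ x. (\<integral>\<^sup>+ s. f (x(i := s - sum x I)) \<partial>lborel) \<partial>?P)"
  proof (rule nn_integral_cong)
    fix x assume x: "x \<in> space ?P"
    have [measurable]: "(\<lambda>u. f (x(i := u))) \<in> borel_measurable borel"
      using x by (intro measurable_compose[OF _ f])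
        (auto intro!: measurable_fun_upd[where J=I] simp: measurable_const)
    show "(\<integral>\<^sup>+ u. f (x(i := u)) \<partial>lborel) = (\<integral>\<^sup>+ s. f (x(i := s - sum x I)) \<partial>lborel)"
      by (subst nn_integral_real_affine[where c=1 and t="- sum x I"]) auto
  qed
  also have "\<dots> = (\<integral>\<^sup>+ s. (\<integral>\<^sup>+ x. f (x(i := s - sum x I)) \<partial>?P) \<partial>lborel)"
    by (rule PL.Fubini'[symmetric]) (use measurable_compose[OF upd f] in \<open>simp add: split_beta\<close>)
  also have "\<dots> = (\<integral>\<^sup>+ s. (\<integral>\<^sup>+ t. f (\<lambda>j\<in>insert i I. y t j + s / n) \<partial>?P) \<partial>lborel)"
  proof (rule nn_integral_cong)
    fix s :: real
    have [measurable]: "(\<lambda>x. f (x(i := s - sum x I))) \<in> borel_measurable ?P"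
      by (intro measurable_compose[OF _ f] measurable_fun_upd[where J=I])
         (auto intro!: borel_measurable_diff borel_measurable_sum)
    \<comment> \<open>Translating the n - 1 free coordinates by s / n leaves s - (n - 1) s / n = s /
      n for coordinate i, so all n coordinates get the same offset.\<close>
    have "(\<integral>\<^sup>+ x. f (x(i := s - sum x I)) \<partial>?P) =
       (\<integral>\<^sup>+ x. f ((\<lambda>j\<in>I. x j + s / n)(i := s - sum (\<lambda>j\<in>I. x j + s / n) I)) \<partial>?P)"
      by (rule nn_integral_PiM_lborel_translate[symmetric]) (use I in auto)
    also have "\<dots> = (\<integral>\<^sup>+ t. f (\<lambda>j\<in>insert i I. y t j + s / n) \<partial>?P)"
    proof (intro nn_integral_cong arg_cong[where f=f] ext)
      fix x j
      have "s - sum (\<lambda>j\<in>I. x j + s / n) I = s - sum x I - (n - 1) * (s / n)"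
        by (simp add: sum.distrib cI)
      also have "\<dots> = - sum x I + s / n" using n by (simp add: field_simps)
      finally have "s - sum (\<lambda>j\<in>I. x j + s / n) I = - sum x I + s / n" .
      then show "((\<lambda>j\<in>I. x j + s / n)(i := s - sum (\<lambda>j\<in>I. x j + s / n) I)) j =
          (\<lambda>j\<in>insert i I. y x j + s / n) j"
        using I by (auto simp: y_def)
    qed
    finally show "(\<integral>\<^sup>+ x. f (x(i := s - sum x I)) \<partial>?P) =
       (\<integral>\<^sup>+ t. f (\<lambda>j\<in>insert i I. y t j + s / n) \<partial>?P)" .
  qed
  finally show ?thesis by (simp add: n_def)
qed

section \<open>Independence of the sum and the deviations\<close>

definition std_normal_PiM :: "'i set \<Rightarrow> ('i \<Rightarrow> real) measure" where
  "std_normal_PiM I = PiM I (\<lambda>_. std_normal_distribution)"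

lemma sets_std_normal_PiM [simp, measurable_cong]:
  "sets (std_normal_PiM I) = sets (PiM I (\<lambda>_. borel))"
  unfolding std_normal_PiM_def by (intro sets_PiM_cong) auto

lemma space_std_normal_PiM: "space (std_normal_PiM I) = extensional I"
  by (simp add: std_normal_PiM_def space_PiM PiE_def)

lemma prob_space_std_normal_PiM: "prob_space (std_normal_PiM I)"
  unfolding std_normal_PiM_def by (intro prob_space_PiM prob_space_normal_density) auto

text \<open>Pythagoras: as y sums to 0, the cross terms vanish and the squares of y_j + s / n add up
  to the squares of the y_j plus s^2 / n. The factor sqrt (2 pi n) normalises the part depending on
  s to the N(0, n) density. This factorisation is the source of the independence.\<close>

lemma normal_density_zero_mean_shift:
  fixes y :: "'i \<Rightarrow> real"
  assumes I: "finite I" "I \<noteq> {}" and y: "sum y I = 0"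
  defines "n \<equiv> real (card I)"
  shows "(\<Prod>j\<in>I. std_normal_density (y j + s / n)) =
    normal_density 0 (sqrt n) s * (sqrt (2 * pi * n) * (\<Prod>j\<in>I. std_normal_density (y j)))"
proof -
  have n: "n > 0" using I by (simp add: n_def card_gt_0_iff)
  have "std_normal_density (a + b) = std_normal_density a * exp (- (2 * a * b + b\<^sup>2) / 2)" for a b
  proof -
    have "- (a + b)\<^sup>2 / 2 = - a\<^sup>2 / 2 + - (2 * a * b + b\<^sup>2) / 2"
      by (simp add: power2_eq_square field_simps)
    then show ?thesis unfolding std_normal_density_def by (simp only: exp_add mult.assoc)
  qed
  then have "(\<Prod>j\<in>I. std_normal_density (y j + s / n)) =
    (\<Prod>j\<in>I. std_normal_density (y j) * exp (- (2 * y j * (s / n) + (s / n)\<^sup>2) / 2))"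
    by simp
  also have "\<dots> = (\<Prod>j\<in>I. std_normal_density (y j)) * exp (\<Sum>j\<in>I. - (2 * y j * (s / n) + (s / n)\<^sup>2) / 2)"
    by (simp add: prod.distrib exp_sum I)
  also have "(\<Sum>j\<in>I. - (2 * y j * (s / n) + (s / n)\<^sup>2) / 2) = - (2 * (s / n) * sum y I + n * (s / n)\<^sup>2) / 2"
  proof -
    have "(\<Sum>j\<in>I. 2 * y j * (s / n) + (s / n)\<^sup>2) = 2 * (s / n) * sum y I + n * (s / n)\<^sup>2"
      by (simp add: sum.distrib sum_distrib_left sum_distrib_right sum_divide_distrib n_def mult_ac)
    then show ?thesis by (simp only: sum_negf sum_divide_distrib[symmetric])
  qed
  also have "\<dots> = - s\<^sup>2 / (2 * n)" using n y by (simp add: power2_eq_square field_simps)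
  also have "exp (- s\<^sup>2 / (2 * n)) = normal_density 0 (sqrt n) s * sqrt (2 * pi * n)"
    using n by (simp add: normal_density_def)
  finally show ?thesis by (simp add: mult_ac)
qed

definition deviation :: "'i set \<Rightarrow> ('i \<Rightarrow> real) \<Rightarrow> 'i \<Rightarrow> real" where
  "deviation I t = (\<lambda>j\<in>I. t j - sum t I / real (card I))"

text \<open>In other words, the coordinate sum is independent of the deviations from the mean.\<close>

lemma nn_integral_sum_deviation:
  fixes f :: "real \<times> ('i \<Rightarrow> real) \<Rightarrow> ennreal"
  assumes I: "finite I" "I \<noteq> {}"
    and f[measurable]: "f \<in> borel_measurable (borel \<Otimes>\<^sub>M PiM I (\<lambda>_. borel))"
  defines "N \<equiv> std_normal_PiM I" and "n \<equiv> real (card I)"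
  shows "(\<integral>\<^sup>+ t. f (sum t I, deviation I t) \<partial>N) =
    (\<integral>\<^sup>+ s. normal_density 0 (sqrt n) s * (\<integral>\<^sup>+ t. f (s, deviation I t) \<partial>N) \<partial>lborel)"
proof -
  obtain i J where J: "I = insert i J" "i \<notin> J" "finite J"
    using I by (metis finite_insert insert_absorb mk_disjoint_insert equals0I)
  have n: "n > 0" using I by (simp add: n_def card_gt_0_iff)
  let ?P = "PiM J (\<lambda>_. lborel :: real measure)" and ?L = "PiM I (\<lambda>_. lborel :: real measure)"
  interpret L: product_sigma_finite "\<lambda>_. lborel :: real measure" ..
  interpret P: sigma_finite_measure ?P by (rule L.sigma_finite) fact
  \<comment> \<open>\<open>y\<close> completes the free deviations to a vector of sum 0, and
    \<open>G\<close> is the joint density of those free deviations.\<close>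
  define y where "y t = t(i := - sum t J)" for t :: "'i \<Rightarrow> real"
  define G where "G t = ennreal (sqrt (2 * pi * n) * (\<Prod>j\<in>I. std_normal_density (y t j)))" for t
  have sets_eq: "sets (PiM I (\<lambda>_. borel)) = sets ?L" "sets N = sets ?L"
    unfolding N_def std_normal_PiM_def by (auto intro!: sets_PiM_cong)
  have y_meas[measurable]: "y \<in> ?P \<rightarrow>\<^sub>M ?L"
    unfolding J y_def
    by (intro measurable_fun_upd[where J=J]) (auto intro!: borel_measurable_uminus borel_measurable_sum)
  have y_space: "y t \<in> extensional I" if "t \<in> space ?P" for t
    using that by (auto simp: y_def space_PiM PiE_def extensional_def J)
  have y_sum: "sum (y t) I = 0" for t
  proof -
    have "sum (y t) J = sum t J" using J by (intro sum.cong) (auto simp: y_def)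
    then show ?thesis using J by (simp add: y_def)
  qed
  have dev_meas[measurable]: "deviation I \<in> ?L \<rightarrow>\<^sub>M ?L"
    unfolding deviation_def by measurable
  have f': "f \<in> borel_measurable (borel \<Otimes>\<^sub>M ?L)"
    using f by (simp cong: measurable_cong_sets sets_pair_measure_cong add: sets_eq)
  have G[measurable]: "G \<in> borel_measurable ?P"
  proof -
    have "(\<lambda>t. y t j) \<in> borel_measurable ?P" if "j \<in> I" for j
      using measurable_compose[OF y_meas measurable_component_singleton[OF that]] by simp
    then show ?thesis unfolding G_def
      by (intro measurable_compose[OF _ measurable_ennreal] borel_measurable_times borel_measurable_const 
        borel_measurable_prod) (auto intro: measurable_compose)
  qed
  have key: "(\<integral>\<^sup>+ t. h (sum t I, deviation I t) \<partial>N) =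
     (\<integral>\<^sup>+ s. normal_density 0 (sqrt n) s * (\<integral>\<^sup>+ t. G t * h (s, y t) \<partial>?P) \<partial>lborel)"
    if h[measurable]: "h \<in> borel_measurable (borel \<Otimes>\<^sub>M ?L)" for h
  proof -
    have sum_meas[measurable]: "(\<lambda>t. sum t I) \<in> borel_measurable ?L" by measurable
    have pair_meas: "(\<lambda>t. (sum t I, deviation I t)) \<in> ?L \<rightarrow>\<^sub>M borel \<Otimes>\<^sub>M ?L" by measurable
    have hm[measurable]: "(\<lambda>t. h (sum t I, deviation I t)) \<in> borel_measurable ?L"
      by (rule measurable_compose[OF pair_meas h])
    have dens[measurable]: "(\<lambda>t. \<Prod>j\<in>I. ennreal (std_normal_density (t j))) \<in> borel_measurable ?L"
      by measurable
    have "(\<integral>\<^sup>+ t. h (sum t I, deviation I t) \<partial>N) =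
       (\<integral>\<^sup>+ t. (\<Prod>j\<in>I. ennreal (std_normal_density (t j))) * h (sum t I, deviation I t) \<partial>?L)"
      unfolding N_def std_normal_PiM_def PiM_std_normal_distribution[OF I(1)] by (intro nn_integral_density) auto
    also have "\<dots> = (\<integral>\<^sup>+ s. (\<integral>\<^sup>+ t. (\<Prod>j\<in>I. ennreal (std_normal_density (y t j + s / n))) *
          h (s, y t) \<partial>?P) \<partial>lborel)"
      unfolding J(1)
    proof (subst nn_integral_PiM_lborel_insert_sum[OF J(3,2)], goal_cases)
      case 1 then show ?case unfolding J(1)[symmetric] by measurable
    next
      case 2
      show ?case unfolding J(1)[symmetric] n_def[symmetric] y_def[symmetric]
      proof (intro nn_integral_cong arg_cong2[where f="(*)"] prod.cong refl)
        fix s t assume t: "t \<in> space ?P"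
        let ?z = "\<lambda>j\<in>I. y t j + s / n"
        have "sum ?z I = s" using y_sum[of t] n by (simp add: sum.distrib n_def)
        moreover have "deviation I ?z = y t"
          using \<open>sum ?z I = s\<close> y_space[OF t] by (auto simp: deviation_def n_def fun_eq_iff extensional_def)
        ultimately show "h (sum ?z I, deviation I ?z) = h (s, y t)" by simp
      qed auto
    qed
    also have "\<dots> = (\<integral>\<^sup>+ s. (\<integral>\<^sup>+ t. normal_density 0 (sqrt n) s * (G t * h (s, y t)) \<partial>?P) \<partial>lborel)"
    proof (intro nn_integral_cong)
      fix s t
      have "(\<Prod>j\<in>I. ennreal (std_normal_density (y t j + s / n))) =
          ennreal (\<Prod>j\<in>I. std_normal_density (y t j + s / n))"
        by (simp add: prod_ennreal)
      also have "\<dots> = ennreal (normal_density 0 (sqrt n) s) * G t"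
        unfolding normal_density_zero_mean_shift[OF I y_sum, folded n_def] G_def
        using n by (intro ennreal_mult mult_nonneg_nonneg prod_nonneg) auto
      finally show "(\<Prod>j\<in>I. ennreal (std_normal_density (y t j + s / n))) * h (s, y t) =
          normal_density 0 (sqrt n) s * (G t * h (s, y t))" by (simp add: mult_ac)
    qed
    also have "\<dots> = (\<integral>\<^sup>+ s. normal_density 0 (sqrt n) s * (\<integral>\<^sup>+ t. G t * h (s, y t) \<partial>?P) \<partial>lborel)"
      by (intro nn_integral_cong nn_integral_cmult) measurable
    finally show ?thesis .
  qed
  \<comment> \<open>\<open>key\<close> for a function that ignores the sum: the normal density
    integrates to 1, which identifies the integral against \<open>G\<close> as the law of the
    deviations. No evaluation of \<open>G\<close> is needed.\<close>
  have "(\<integral>\<^sup>+ t. f (s, deviation I t) \<partial>N) = (\<integral>\<^sup>+ t. G t * f (s, y t) \<partial>?P)" for s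
  proof -
    have "(\<integral>\<^sup>+ t. f (s, deviation I t) \<partial>N) =
       (\<integral>\<^sup>+ u. normal_density 0 (sqrt n) u * (\<integral>\<^sup>+ t. G t * f (s, y t) \<partial>?P) \<partial>lborel)"
      using key[of "\<lambda>(_, x). f (s, x)"] f' by simp
    also have "\<dots> = (\<integral>\<^sup>+ u. normal_density 0 (sqrt n) u \<partial>lborel) * (\<integral>\<^sup>+ t. G t * f (s, y t) \<partial>?P)"
      by (intro nn_integral_multc) auto
    also have "(\<integral>\<^sup>+ u. normal_density 0 (sqrt n) u \<partial>lborel) = 1"
      using n by (subst nn_integral_eq_integral) (auto simp: integrable_normal_density integral_normal_density)
    finally show ?thesis by simp
  qed
  then show ?thesis using key[OF f'] by simp
qed

section \<open>The sum restricted to an event\<close>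

text \<open>An explicit version, defined for every s, of the conditional probability of
  \<open>B\<close> given that the coordinate sum is s: by independence, conditioning only fixes the
  mean s / n that is added to the deviations.\<close>

definition shifted_deviation_prob :: "'i set \<Rightarrow> ('i \<Rightarrow> real) set \<Rightarrow> real \<Rightarrow> real" where
  "shifted_deviation_prob I B s =
     (LINT t|std_normal_PiM I. indicator B (\<lambda>j\<in>I. deviation I t j + s / real (card I)))"

lemma shifted_deviation_prob_nonneg: "0 \<le> shifted_deviation_prob I B s"
  unfolding shifted_deviation_prob_def by simp

lemma measurable_shifted_deviation:
  assumes "finite I"
  shows "(\<lambda>(s, t). \<lambda>j\<in>I. deviation I t j + s / real (card I)) \<in>
    borel \<Otimes>\<^sub>M PiM I (\<lambda>_. borel) \<rightarrow>\<^sub>M PiM I (\<lambda>_. borel)"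
  unfolding split_beta
proof (rule measurable_restrict)
  fix j assume j: "j \<in> I"
  have comp: "(\<lambda>p :: real \<times> ('a \<Rightarrow> real). snd p i) \<in> borel_measurable (borel \<Otimes>\<^sub>M PiM I (\<lambda>_. borel))" if "i \<in> I" for i
    using that by measurable
  have "(\<lambda>p :: real \<times> ('a \<Rightarrow> real). (snd p j - sum (snd p) I / real (card I)) + fst p / real (card I)) \<in>
      borel_measurable (borel \<Otimes>\<^sub>M PiM I (\<lambda>_. borel))"
    using comp j by (intro borel_measurable_add borel_measurable_diff borel_measurable_divide borel_measurable_sum) auto
  then show "(\<lambda>p :: real \<times> ('a \<Rightarrow> real). deviation I (snd p) j + fst p / real (card I)) \<in>
      borel_measurable (borel \<Otimes>\<^sub>M PiM I (\<lambda>_. borel))"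
    using j by (simp add: deviation_def)
qed

text \<open>At 0 this density is, up to the factor $(2 \pi n)^{-1/2}$, the probability that the deviation
  vector lies in $B$: the quantity that Fourier inversion recovers.\<close>

lemma distr_sum_restricted:
  fixes I :: "'i set"
  assumes I: "finite I" "I \<noteq> {}" and B[measurable]: "B \<in> sets (PiM I (\<lambda>_. borel))"
  shows "distr (density (std_normal_PiM I) (indicator B)) borel (\<lambda>t. sum t I) =
    density lborel (\<lambda>s. ennreal (normal_density 0 (sqrt (card I)) s * shifted_deviation_prob I B s))"
    and "shifted_deviation_prob I B \<in> borel_measurable borel"
proof -
  let ?N = "std_normal_PiM I" and ?n = "real (card I)"
  let ?T = "\<lambda>s x. \<lambda>j\<in>I. x j + s / ?n"
  interpret N: prob_space ?N by (rule prob_space_std_normal_PiM)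
  have T[measurable]: "(\<lambda>(s, x). ?T s x) \<in> borel \<Otimes>\<^sub>M PiM I (\<lambda>_. borel) \<rightarrow>\<^sub>M PiM I (\<lambda>_. borel)"
    by measurable
  have Td: "(\<lambda>(s, t). ?T s (deviation I t)) \<in> borel \<Otimes>\<^sub>M PiM I (\<lambda>_. borel) \<rightarrow>\<^sub>M PiM I (\<lambda>_. borel)"
    using measurable_shifted_deviation[OF I(1)] .
  have Td': "(\<lambda>t. ?T s (deviation I t)) \<in> ?N \<rightarrow>\<^sub>M PiM I (\<lambda>_. borel)" for s
    using measurable_compose[OF measurable_Pair1' Td, of s] by (simp cong: measurable_cong_sets)
  have "(\<lambda>p. indicator B (case p of (s, t) \<Rightarrow> ?T s (deviation I t)) :: real) \<in>
      borel_measurable (borel \<Otimes>\<^sub>M PiM I (\<lambda>_. borel))"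
    by (rule measurable_compose[OF Td borel_measurable_indicator[OF B]])
  then have "(\<lambda>(s, t). indicator B (?T s (deviation I t)) :: real) \<in> borel_measurable (borel \<Otimes>\<^sub>M ?N)"
    by (simp add: split_beta cong: measurable_cong_sets sets_pair_measure_cong)
  then show Q[measurable]: "shifted_deviation_prob I B \<in> borel_measurable borel"
    unfolding shifted_deviation_prob_def[abs_def] by (rule N.borel_measurable_lebesgue_integral)
  have Q_eq: "(\<integral>\<^sup>+ t. indicator B (?T s (deviation I t)) \<partial>?N) = ennreal (shifted_deviation_prob I B s)" for s
  proof -
    have "integrable ?N (\<lambda>t. indicator B (?T s (deviation I t)) :: real)"
      by (rule N.integrable_const_bound[of _ 1])
         (use measurable_compose[OF Td' borel_measurable_indicator[OF B]] in \<open>auto simp: indicator_def\<close>)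
    then have "(\<integral>\<^sup>+ t. ennreal (indicator B (?T s (deviation I t))) \<partial>?N) = ennreal (shifted_deviation_prob I B s)"
      unfolding shifted_deviation_prob_def by (rule nn_integral_eq_integral) auto
    then show ?thesis by (simp add: ennreal_indicator)
  qed
  show "distr (density ?N (indicator B)) borel (\<lambda>t. sum t I) =
    density lborel (\<lambda>s. ennreal (normal_density 0 (sqrt ?n) s * shifted_deviation_prob I B s))"
  proof (rule measure_eqI)
    fix A assume "A \<in> sets (distr (density ?N (indicator B)) borel (\<lambda>t. sum t I))"
    then have A[measurable]: "A \<in> sets borel" by simp
    \<comment> \<open>At the sum and the deviations of t the vector \<open>?T s x\<close> is t
      again, so \<open>?f\<close> tests whether t lies in \<open>B\<close> and its sum in
      \<open>A\<close>.\<close>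
    let ?f = "\<lambda>(s, x). indicator B (?T s x) * indicator A s :: ennreal"
    have f: "?f \<in> borel_measurable (borel \<Otimes>\<^sub>M PiM I (\<lambda>_. borel))"
      using measurable_compose[OF T borel_measurable_indicator[OF B]] 
      by (simp add: split_beta)
    have sum_meas[measurable]: "(\<lambda>t. sum t I) \<in> borel_measurable ?N" by measurable
    have "emeasure (distr (density ?N (indicator B)) borel (\<lambda>t. sum t I)) A =
       (\<integral>\<^sup>+ s. indicator A s \<partial>distr (density ?N (indicator B)) borel (\<lambda>t. sum t I))"
      by simp
    also have "\<dots> = (\<integral>\<^sup>+ t. indicator A (sum t I) \<partial>density ?N (indicator B))"
      by (rule nn_integral_distr) auto
    also have "\<dots> = (\<integral>\<^sup>+ t. indicator B t * indicator A (sum t I) \<partial>?N)"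
      by (rule nn_integral_density) auto
    also have "\<dots> = (\<integral>\<^sup>+ t. ?f (sum t I, deviation I t) \<partial>?N)"
    proof (rule nn_integral_cong)
      fix t assume "t \<in> space ?N"
      then have "?T (sum t I) (deviation I t) = t"
        by (auto simp: space_std_normal_PiM deviation_def fun_eq_iff extensional_def)
      then show "indicator B t * indicator A (sum t I) = ?f (sum t I, deviation I t)" by simp
    qed
    also have "\<dots> = (\<integral>\<^sup>+ s. normal_density 0 (sqrt ?n) s * (\<integral>\<^sup>+ t. ?f (s, deviation I t) \<partial>?N) \<partial>lborel)"
      by (rule nn_integral_sum_deviation[OF I f])
    also have "\<dots> = (\<integral>\<^sup>+ s. ennreal (normal_density 0 (sqrt ?n) s * shifted_deviation_prob I B s) * indicator A s \<partial>lborel)"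
    proof (rule nn_integral_cong)
      fix s
      have "(\<integral>\<^sup>+ t. ?f (s, deviation I t) \<partial>?N) = ennreal (shifted_deviation_prob I B s) * indicator A s"
      proof -
        have "(\<lambda>t. indicator B (?T s (deviation I t)) :: ennreal) \<in> borel_measurable ?N"
          by (rule measurable_compose[OF Td' borel_measurable_indicator[OF B]])
        then show ?thesis by (simp add: nn_integral_multc Q_eq)
      qed
      then show "normal_density 0 (sqrt ?n) s * (\<integral>\<^sup>+ t. ?f (s, deviation I t) \<partial>?N) =
          ennreal (normal_density 0 (sqrt ?n) s * shifted_deviation_prob I B s) * indicator A s"
        by (simp add: ennreal_mult shifted_deviation_prob_nonneg mult.assoc)
    qed
    also have "\<dots> = emeasure (density lborel (\<lambda>s. ennreal (normal_density 0 (sqrt ?n) s * shifted_deviation_prob I B s))) A"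
      by (rule emeasure_density[symmetric]) auto
    finally show "emeasure (distr (density ?N (indicator B)) borel (\<lambda>t. sum t I)) A =
      emeasure (density lborel (\<lambda>s. ennreal (normal_density 0 (sqrt ?n) s * shifted_deviation_prob I B s))) A" .
  qed auto
qed

lemma integral_sum_restricted:
  fixes h :: "real \<Rightarrow> complex"
  assumes I: "finite I" "I \<noteq> {}" and B[measurable]: "B \<in> sets (PiM I (\<lambda>_. borel))"
    and h[measurable]: "h \<in> borel_measurable borel"
  shows "(LINT t|std_normal_PiM I. indicator B t *\<^sub>R h (sum t I)) =
    (CLBINT s. (normal_density 0 (sqrt (card I)) s * shifted_deviation_prob I B s) *\<^sub>R h s)"
proof -
  let ?N = "std_normal_PiM I"
  note [measurable] = distr_sum_restricted(2)[OF I B]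
  have sum_meas[measurable]: "(\<lambda>t. sum t I) \<in> borel_measurable ?N" by measurable
  have "(LINT t|?N. indicator B t *\<^sub>R h (sum t I)) = (LINT t|density ?N (\<lambda>t. ennreal (indicator B t)). h (sum t I))"
    by (rule integral_density[symmetric]) auto
  also have "\<dots> = (LINT s|distr (density ?N (indicator B)) borel (\<lambda>t. sum t I). h s)"
    by (subst integral_distr) (auto simp: ennreal_indicator)
  also have "\<dots> = (CLBINT s. (normal_density 0 (sqrt (card I)) s * shifted_deviation_prob I B s) *\<^sub>R h s)"
    unfolding distr_sum_restricted(1)[OF I B]
    by (rule integral_density) (auto intro!: mult_nonneg_nonneg shifted_deviation_prob_nonneg)
  finally show ?thesis .
qed

subsection \<open>Fourier inversion at the origin\<close>

text \<open>The Gaussian weight makes the double integral absolutely convergent, so the order can be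
  exchanged. The integral over w is then a normal characteristic function, again Gaussian, and what
  remains is the mean of q under N(0, e^2). The factors 1 / e and e from the two rescalings
  cancel.\<close>

lemma fourier_gaussian_smoothing:
  fixes q :: "real \<Rightarrow> real"
  assumes q: "integrable lborel q" and e: "e > 0"
  shows "(CLBINT w. std_normal_density (e * w) *\<^sub>R (CLBINT s. q s *\<^sub>R iexp (- w * s))) =
    of_real (sqrt (2 * pi) * (LBINT r. q (e * r) * std_normal_density r))"
proof -
  let ?\<phi> = std_normal_density
  have [measurable]: "q \<in> borel_measurable borel" using borel_measurable_integrable[OF q] by simp
  have "(CLBINT w. ?\<phi> (e * w) *\<^sub>R (CLBINT s. q s *\<^sub>R iexp (- w * s))) =
     (1 / e) *\<^sub>R (CLBINT u. ?\<phi> u *\<^sub>R (CLBINT s. q s *\<^sub>R iexp (- (u / e) * s)))"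
    by (subst lborel_integral_real_affine[where c="1 / e" and t=0]) (use e in auto)
  also have "(CLBINT u. ?\<phi> u *\<^sub>R (CLBINT s. q s *\<^sub>R iexp (- (u / e) * s))) =
      (CLBINT u. CLBINT s. (?\<phi> u * q s) *\<^sub>R iexp (- (u / e) * s))"
    by (simp flip: integral_scaleR_right)
  also have "\<dots> = (CLBINT s. CLBINT u. (?\<phi> u * q s) *\<^sub>R iexp (- (u / e) * s))"
  proof (rule lborel_pair.Fubini_integral[symmetric])
    have "integrable lborel (\<lambda>u. ?\<phi> u * (LBINT s. \<bar>q s\<bar>))"
      by (simp add: integrable_normal_density)
    moreover have "integrable lborel (\<lambda>s. (?\<phi> u * q s) *\<^sub>R iexp (- (u / e) * s))" for u
      by (rule Bochner_Integration.integrable_bound[of _ "\<lambda>s. ?\<phi> u * q s"]) (use q in auto)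
    ultimately show "integrable (lborel \<Otimes>\<^sub>M lborel) (\<lambda>(u, s). (?\<phi> u * q s) *\<^sub>R iexp (- (u / e) * s))"
      by (intro lborel_pair.Fubini_integrable) (auto simp: norm_mult abs_mult)
  qed
  also have "\<dots> = (CLBINT s. of_real (q s * exp (- (s / e)\<^sup>2 / 2)))"
  proof (rule Bochner_Integration.integral_cong[OF refl])
    fix s
    have "(CLBINT u. ?\<phi> u *\<^sub>R iexp (- (s / e) * u)) = char std_normal_distribution (- (s / e))"
      unfolding char_def by (subst integral_density) auto
    then have *: "(CLBINT u. ?\<phi> u *\<^sub>R iexp (- (s / e) * u)) = of_real (exp (- (s / e)\<^sup>2 / 2))"
      by (simp add: char_std_normal_distribution)
    have "(CLBINT u. (?\<phi> u * q s) *\<^sub>R iexp (- (u / e) * s)) =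
        (CLBINT u. q s *\<^sub>R (?\<phi> u *\<^sub>R iexp (- (s / e) * u)))"
      by (simp add: mult_ac)
    also have "\<dots> = q s *\<^sub>R of_real (exp (- (s / e)\<^sup>2 / 2))"
      unfolding integral_scaleR_right * ..
    finally show "(CLBINT u. (?\<phi> u * q s) *\<^sub>R iexp (- (u / e) * s)) = of_real (q s * exp (- (s / e)\<^sup>2 / 2))"
      by (simp add: scaleR_conv_of_real)
  qed
  also have "\<dots> = of_real (LBINT s. q s * exp (- (s / e)\<^sup>2 / 2))"
    by (rule integral_complex_of_real)
  also have "(LBINT s. q s * exp (- (s / e)\<^sup>2 / 2)) = e * (LBINT r. q (e * r) * exp (- r\<^sup>2 / 2))"
    by (subst lborel_integral_real_affine[where c=e and t=0]) (use e in auto)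
  also have "(LBINT r. q (e * r) * exp (- r\<^sup>2 / 2)) = (LBINT r. sqrt (2 * pi) * (q (e * r) * ?\<phi> r))"
    by (simp add: std_normal_density_def)
  finally show ?thesis using e by (simp add: scaleR_conv_of_real)
qed

text \<open>Let e tend to 0 in the smoothed identity. Integrability of the transform dominates the
  left side and boundedness of q the right side, where the mass concentrates at 0; continuity of q
  is used at that point only. The limits are \<open>std_normal_density 0\<close> times the desired
  integral and sqrt (2 pi) q(0), whence the factor 2 pi.\<close>

lemma fourier_inversion_at_0:
  fixes q :: "real \<Rightarrow> real"
  assumes q: "integrable lborel q" and bound: "\<And>s. \<bar>q s\<bar> \<le> C" and cont: "isCont q 0"
    and \<psi>: "integrable lborel (\<lambda>w. CLBINT s. q s *\<^sub>R iexp (- w * s))"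
  shows "(CLBINT w. CLBINT s. q s *\<^sub>R iexp (- w * s)) = of_real (2 * pi * q 0)"
proof -
  let ?\<phi> = std_normal_density
  define \<psi> where "\<psi> w = (CLBINT s. q s *\<^sub>R iexp (- w * s))" for w
  define e where "e i = inverse (real (Suc i))" for i
  have e0: "e \<longlonglongrightarrow> 0" unfolding e_def[abs_def] by (rule LIMSEQ_inverse_real_of_nat)
  have [measurable]: "q \<in> borel_measurable borel" using borel_measurable_integrable[OF q] by simp
  have \<psi>_int: "integrable lborel \<psi>" using \<psi> by (simp add: \<psi>_def[abs_def])
  note [measurable] = borel_measurable_integrable[OF \<psi>_int]
  have "(\<lambda>i. CLBINT w. ?\<phi> (e i * w) *\<^sub>R \<psi> w) \<longlonglongrightarrow> (CLBINT w. ?\<phi> 0 *\<^sub>R \<psi> w)"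
  proof (rule integral_dominated_convergence[where w="\<lambda>w. norm (\<psi> w)"])
    show "AE w in lborel. (\<lambda>i. ?\<phi> (e i * w) *\<^sub>R \<psi> w) \<longlonglongrightarrow> ?\<phi> 0 *\<^sub>R \<psi> w"
    proof (intro AE_I2 tendsto_scaleR tendsto_const)
      fix w
      have "isCont ?\<phi> 0" unfolding std_normal_density_def by (intro continuous_intros) auto
      moreover have "(\<lambda>i. e i * w) \<longlonglongrightarrow> 0" using tendsto_mult_left_zero[OF e0] .
      ultimately show "(\<lambda>i. ?\<phi> (e i * w)) \<longlonglongrightarrow> ?\<phi> 0" using isCont_tendsto_compose by blast
    qed
    have "?\<phi> x \<le> 1" for x
    proof -
      have "1 / sqrt (2 * pi) \<le> 1" using pi_gt3 by simp
      then have "1 / sqrt (2 * pi) * exp (- x\<^sup>2 / 2) \<le> 1 * 1" by (intro mult_mono) auto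
      then show ?thesis by (simp add: std_normal_density_def)
    qed
    then show "AE w in lborel. norm (?\<phi> (e i * w) *\<^sub>R \<psi> w) \<le> norm (\<psi> w)" for i
      by (auto simp: mult_left_le_one_le)
  qed (use \<psi>_int in auto)
  then have "(\<lambda>i. CLBINT w. ?\<phi> (e i * w) *\<^sub>R \<psi> w) \<longlonglongrightarrow> ?\<phi> 0 *\<^sub>R (CLBINT w. \<psi> w)"
    by simp
  moreover have "(\<lambda>i. CLBINT w. ?\<phi> (e i * w) *\<^sub>R \<psi> w) \<longlonglongrightarrow> of_real (sqrt (2 * pi) * q 0)"
  proof -
    have "(\<lambda>i. LBINT r. q (e i * r) * ?\<phi> r) \<longlonglongrightarrow> (LBINT r. q 0 * ?\<phi> r)"
    proof (rule integral_dominated_convergence[where w="\<lambda>r. C * ?\<phi> r"])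
      show "AE r in lborel. (\<lambda>i. q (e i * r) * ?\<phi> r) \<longlonglongrightarrow> q 0 * ?\<phi> r"
      proof (intro AE_I2 tendsto_mult tendsto_const)
        fix r
        have "(\<lambda>i. e i * r) \<longlonglongrightarrow> 0" using tendsto_mult_left_zero[OF e0] .
        then show "(\<lambda>i. q (e i * r)) \<longlonglongrightarrow> q 0" using isCont_tendsto_compose[OF cont] by blast
      qed
      show "AE r in lborel. norm (q (e i * r) * ?\<phi> r) \<le> C * ?\<phi> r" for i
        using bound by (auto simp: abs_mult intro!: mult_right_mono)
    qed (auto simp: integrable_normal_density)
    then have "(\<lambda>i. LBINT r. q (e i * r) * ?\<phi> r) \<longlonglongrightarrow> q 0"
      by (simp add: integral_normal_density)
    then have "(\<lambda>i. complex_of_real (sqrt (2 * pi) * (LBINT r. q (e i * r) * ?\<phi> r))) \<longlonglongrightarrow> of_real (sqrt (2 * pi) * q 0)"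
      by (intro tendsto_of_real tendsto_mult tendsto_const)
    then show ?thesis
      unfolding \<psi>_def by (subst fourier_gaussian_smoothing[OF q]) (auto simp: e_def)
  qed
  ultimately have "?\<phi> 0 *\<^sub>R (CLBINT w. \<psi> w) = of_real (sqrt (2 * pi) * q 0)"
    by (rule LIMSEQ_unique)
  then have "sqrt (2 * pi) *\<^sub>R (?\<phi> 0 *\<^sub>R (CLBINT w. \<psi> w)) = sqrt (2 * pi) *\<^sub>R of_real (sqrt (2 * pi) * q 0)"
    by simp
  then show ?thesis
    by (simp add: std_normal_density_def \<psi>_def scaleR_conv_of_real flip: of_real_mult)
qed

subsection \<open>Orthant probabilities\<close>

definition sign_orthant :: "'i set \<Rightarrow> 'i set \<Rightarrow> ('i \<Rightarrow> real) set" where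
  "sign_orthant J I = {t \<in> extensional I. (\<forall>i\<in>I. if i \<in> J then t i \<le> 0 else 0 \<le> t i)}"

lemma sets_sign_orthant:
  assumes "finite I"
  shows "sign_orthant J I \<in> sets (PiM I (\<lambda>_. borel))"
proof -
  have "sign_orthant J I = Pi\<^sub>E I (\<lambda>i. if i \<in> J then {..0} else {0..})"
    by (auto simp: sign_orthant_def PiE_def Pi_def split: if_splits)
  also have "\<dots> \<in> sets (PiM I (\<lambda>_. borel))"
    using assms by (intro sets_PiM_I_finite) auto
  finally show ?thesis .
qed

text \<open>The orthant is a box and the exponential of a sum is a product, so the expectation
  factors over the coordinates: those in \<open>J\<close> give \<open>half_char w\<close>, the
  others its reflected form.\<close>

lemma char_sum_sign_orthant:
  assumes "finite I" "J \<subseteq> I"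
  shows "(LINT t|std_normal_PiM I. indicator (sign_orthant J I) t *\<^sub>R iexp (- w * sum t I)) =
    half_char w ^ card J * half_char (- w) ^ card (I - J)"
proof -
  interpret N: prob_space std_normal_distribution by (rule prob_space_normal_density) auto
  interpret N: product_sigma_finite "\<lambda>_. std_normal_distribution"
    by standard (rule N.sigma_finite_countable)
  define f where "f i u = indicator (if i \<in> J then {..0} else {0..}) u *\<^sub>R iexp (- w * u)" for i and u :: real
  have "(LINT t|std_normal_PiM I. indicator (sign_orthant J I) t *\<^sub>R iexp (- w * sum t I)) =
     (LINT t|std_normal_PiM I. (\<Prod>i\<in>I. f i (t i)))"
  proof (rule Bochner_Integration.integral_cong[OF refl])
    fix t assume "t \<in> space (std_normal_PiM I)"
    then have t: "t \<in> extensional I" by (simp add: space_std_normal_PiM)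
    have "(\<Prod>i\<in>I. f i (t i)) = (\<Prod>i\<in>I. of_real (indicator (if i \<in> J then {..0} else {0..}) (t i))) *
        (\<Prod>i\<in>I. iexp (- w * t i))"
      by (simp only: f_def scaleR_conv_of_real prod.distrib)
    also have "(\<Prod>i\<in>I. iexp (- w * t i)) = iexp (- w * sum t I)"
      using assms by (simp add: exp_sum[symmetric] sum_distrib_left sum_negf)
    also have "(\<Prod>i\<in>I. complex_of_real (indicator (if i \<in> J then {..0} else {0..}) (t i))) =
        of_real (indicator (sign_orthant J I) t)"
    proof (cases "t \<in> sign_orthant J I")
      case True
      then show ?thesis by (auto simp: sign_orthant_def intro!: prod.neutral split: if_splits)
    next
      case False
      then obtain i where "i \<in> I" "\<not> (if i \<in> J then t i \<le> 0 else 0 \<le> t i)"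
        using t by (auto simp: sign_orthant_def)
      then have "(\<Prod>i\<in>I. complex_of_real (indicator (if i \<in> J then {..0} else {0..}) (t i))) = 0"
        using assms by (intro prod_zero) (auto intro!: bexI[of _ i] split: if_splits)
      then show ?thesis using False by simp
    qed
    finally show "indicator (sign_orthant J I) t *\<^sub>R iexp (- w * sum t I) = (\<Prod>i\<in>I. f i (t i))"
      by (simp add: scaleR_conv_of_real)
  qed
  also have "\<dots> = (\<Prod>i\<in>I. LINT u|std_normal_distribution. f i u)"
    unfolding std_normal_PiM_def
  proof (rule N.product_integral_prod[OF assms(1)])
    fix i
    show "integrable std_normal_distribution (f i)"
    proof (rule N.integrable_const_bound[of _ 1])
      show "f i \<in> borel_measurable std_normal_distribution"
        unfolding f_def[abs_def] by (cases "i \<in> J") auto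
    qed (auto simp: f_def indicator_def)
  qed
  also have "\<dots> = (\<Prod>i\<in>I. if i \<in> J then half_char w else half_char (- w))"
    by (intro prod.cong refl) (auto simp: f_def half_char_std_normal_distribution(1)[of w] half_char_std_normal_distribution(2))
  also have "\<dots> = half_char w ^ card J * half_char (- w) ^ card (I - J)"
    using assms by (subst prod.If_cases) (auto simp: Int_absorb1 Diff_eq[symmetric] Int_Diff)
  finally show ?thesis .
qed

text \<open>With the other coordinates fixed, the deviation of coordinate i vanishes for a single
  value of that coordinate, a null event. For a single coordinate the deviation is identically 0,
  hence the bound on \<open>card I\<close>.\<close>

lemma AE_deviation_nonzero:
  assumes I: "finite I" "card I \<ge> 2"
  shows "AE t in std_normal_PiM I. \<forall>i\<in>I. deviation I t i \<noteq> 0"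
proof (rule AE_finite_allI[OF I(1)])
  fix i assume i: "i \<in> I"
  interpret N: prob_space std_normal_distribution by (rule prob_space_normal_density) auto
  interpret P: product_sigma_finite "\<lambda>_. std_normal_distribution"
    by standard (rule N.sigma_finite_countable)
  define J where "J = I - {i}"
  have J: "finite J" "i \<notin> J" "I = insert i J" using I i by (auto simp: J_def)
  let ?n = "real (card I)"
  let ?Z = "{t \<in> space (std_normal_PiM I). deviation I t i = 0}"
  have dev: "deviation I t i = t i - sum t I / ?n" for t using i by (simp add: deviation_def)
  have "(\<lambda>t. t i - sum t I / ?n) \<in> borel_measurable (std_normal_PiM I)"
    using i by (intro borel_measurable_diff borel_measurable_divide) measurable
  then have Z[measurable]: "?Z \<in> sets (std_normal_PiM I)" unfolding dev by measurable
  have "emeasure (std_normal_PiM I) ?Z = (\<integral>\<^sup>+ t. indicator ?Z t \<partial>PiM (insert i J) (\<lambda>_. std_normal_distribution))"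
    using Z by (simp add: std_normal_PiM_def J(3))
  also have "\<dots> = (\<integral>\<^sup>+ x. (\<integral>\<^sup>+ u. indicator ?Z (x(i := u)) \<partial>std_normal_distribution) \<partial>PiM J (\<lambda>_. std_normal_distribution))"
    using J Z by (intro P.product_nn_integral_insert) (auto simp: std_normal_PiM_def)
  also have "\<dots> = (\<integral>\<^sup>+ x. 0 \<partial>PiM J (\<lambda>_. std_normal_distribution))"
  proof (rule nn_integral_cong)
    fix x
    \<comment> \<open>The solution u of u = (u + \<open>sum x J\<close>) / n.\<close>
    define c where "c = sum x J / (?n - 1)"
    have c: "u = c" if "x(i := u) \<in> ?Z" for u
    proof -
      have "sum (x(i := u)) I = u + sum x J"
        using J by (auto intro!: sum.cong)
      then have "u - (u + sum x J) / ?n = 0" using that by (simp add: dev)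
      moreover have "?n \<ge> 2" using I by linarith
      ultimately show ?thesis by (simp add: c_def field_simps)
    qed
    have "AE u in std_normal_distribution. u \<noteq> c"
      by (subst AE_density) (use AE_lborel_singleton[of c] in auto)
    then have "AE u in std_normal_distribution. (indicator ?Z (x(i := u)) :: ennreal) = 0"
      by eventually_elim (use c in \<open>auto simp: indicator_def\<close>)
    then have "(\<integral>\<^sup>+ u. indicator ?Z (x(i := u)) \<partial>std_normal_distribution) = (\<integral>\<^sup>+ u. 0 \<partial>std_normal_distribution)"
      by (rule nn_integral_cong_AE)
    then show "(\<integral>\<^sup>+ u. indicator ?Z (x(i := u)) \<partial>std_normal_distribution) = 0" by simp
  qed
  finally have "emeasure (std_normal_PiM I) ?Z = 0" by simp
  then show "AE t in std_normal_PiM I. deviation I t i \<noteq> 0"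
    using Z by (subst AE_iff_measurable[OF Z]) auto
qed

text \<open>Where no deviation is 0, a small enough shift changes no sign, so the indicator is
  eventually constant along any sequence tending to 0. Dominated convergence with the constant 1
  does the rest.\<close>

lemma isCont_shifted_deviation_prob:
  assumes I: "finite I" "card I \<ge> 2"
  shows "isCont (shifted_deviation_prob I (sign_orthant J I)) 0"
  unfolding continuous_at_sequentially
proof (intro allI impI)
  let ?N = "std_normal_PiM I" and ?n = "real (card I)" and ?B = "sign_orthant J I"
  let ?T = "\<lambda>s t. \<lambda>j\<in>I. deviation I t j + s / ?n"
  interpret N: prob_space ?N by (rule prob_space_std_normal_PiM)
  fix X :: "nat \<Rightarrow> real" assume X: "X \<longlonglongrightarrow> 0"
  have meas: "(\<lambda>t. indicator ?B (?T s t) :: real) \<in> borel_measurable ?N" for s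
  proof -
    have "?T s \<in> ?N \<rightarrow>\<^sub>M PiM I (\<lambda>_. borel)"
      using measurable_compose[OF measurable_Pair1' measurable_shifted_deviation[OF I(1)], of s]
      by (simp cong: measurable_cong_sets)
    then show ?thesis
      by (rule measurable_compose[OF _ borel_measurable_indicator[OF sets_sign_orthant[OF I(1)]]])
  qed
  have "(\<lambda>i. LINT t|?N. (indicator ?B (?T (X i) t) :: real)) \<longlonglongrightarrow> (LINT t|?N. (indicator ?B (?T 0 t) :: real))"
  proof (rule integral_dominated_convergence[where w="\<lambda>_. 1"])
    show "AE t in ?N. (\<lambda>i. indicator ?B (?T (X i) t) :: real) \<longlonglongrightarrow> indicator ?B (?T 0 t)"
      using AE_deviation_nonzero[OF I]
    proof eventually_elim
      fix t assume t: "\<forall>i\<in>I. deviation I t i \<noteq> 0"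
      have "\<forall>\<^sub>F i in sequentially. \<forall>j\<in>I. (deviation I t j + X i / ?n \<le> 0 \<longleftrightarrow> deviation I t j \<le> 0) \<and>
          (0 \<le> deviation I t j + X i / ?n \<longleftrightarrow> 0 \<le> deviation I t j)"
      proof (rule eventually_ball_finite[OF I(1)], rule ballI)
        fix j assume j: "j \<in> I"
        have lim: "(\<lambda>i. deviation I t j + X i / ?n) \<longlonglongrightarrow> deviation I t j + 0 / ?n"
          using I by (intro tendsto_intros X) auto
        show "\<forall>\<^sub>F i in sequentially. (deviation I t j + X i / ?n \<le> 0 \<longleftrightarrow> deviation I t j \<le> 0) \<and>
          (0 \<le> deviation I t j + X i / ?n \<longleftrightarrow> 0 \<le> deviation I t j)"
        proof (cases "deviation I t j < 0")
          case True
          then have "\<forall>\<^sub>F i in sequentially. deviation I t j + X i / ?n < 0"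
            using lim by (intro order_tendstoD(2)) auto
          then show ?thesis by eventually_elim (use True in auto)
        next
          case False
          then have pos: "deviation I t j > 0" using t j by force
          then have "\<forall>\<^sub>F i in sequentially. deviation I t j + X i / ?n > 0"
            using lim by (intro order_tendstoD(1)) auto
          then show ?thesis by eventually_elim (use pos in auto)
        qed
      qed
      then have "\<forall>\<^sub>F i in sequentially. (indicator ?B (?T (X i) t) :: real) = indicator ?B (?T 0 t)"
        by eventually_elim (auto simp: indicator_def sign_orthant_def)
      then show "(\<lambda>i. indicator ?B (?T (X i) t) :: real) \<longlonglongrightarrow> indicator ?B (?T 0 t)"
        by (rule tendsto_eventually)
    qed
  qed (use meas meas[of 0] in \<open>auto simp: indicator_def\<close>)
  then show "(shifted_deviation_prob I ?B \<circ> X) \<longlonglongrightarrow> shifted_deviation_prob I ?B 0"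
    by (simp add: shifted_deviation_prob_def o_def)
qed

text \<open>The integrand is the Fourier transform of q, the density of the sum on the orthant
  event. Inversion gives 2 pi q(0), and 1 / sqrt (2 pi n) is the N(0, n) density at 0.\<close>

lemma integral_half_char_power:
  assumes I: "finite I" "card I \<ge> 2" and J: "J \<subseteq> I"
  shows "(CLBINT w. half_char w ^ card J * half_char (- w) ^ card (I - J)) =
    of_real (2 * pi / sqrt (2 * pi * card I) * shifted_deviation_prob I (sign_orthant J I) 0)"
proof -
  let ?Q = "shifted_deviation_prob I (sign_orthant J I)" and ?n = "real (card I)"
  interpret N: prob_space "std_normal_PiM I" by (rule prob_space_std_normal_PiM)
  have ne: "I \<noteq> {}" and n: "?n > 0" using I by auto
  note B = sets_sign_orthant[OF I(1), of J]
  note [measurable] = distr_sum_restricted(2)[OF I(1) ne B]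
  define q where "q s = normal_density 0 (sqrt ?n) s * ?Q s" for s
  have Q_le: "?Q s \<le> 1" for s
  proof -
    have "?Q s \<le> (LINT t|std_normal_PiM I. 1)"
      unfolding shifted_deviation_prob_def
      by (rule integral_mono_AE') (auto simp: indicator_def)
    then show ?thesis by (simp add: N.prob_space)
  qed
  have Q_abs: "\<bar>?Q s\<bar> \<le> 1" for s
    using Q_le[of s] shifted_deviation_prob_nonneg[of I "sign_orthant J I" s] by simp
  have nd_le: "normal_density 0 (sqrt ?n) s \<le> 1 / sqrt (2 * pi * ?n)" for s
    using n by (simp add: normal_density_def divide_simps)
  have \<psi>: "half_char w ^ card J * half_char (- w) ^ card (I - J) = (CLBINT s. q s *\<^sub>R iexp (- w * s))" for w
    unfolding q_def char_sum_sign_orthant[OF I(1) J, symmetric]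
    using integral_sum_restricted[OF I(1) ne B, of "\<lambda>s. iexp (- w * s)"] by simp
  have "(CLBINT w. CLBINT s. q s *\<^sub>R iexp (- w * s)) = of_real (2 * pi * q 0)"
  proof (rule fourier_inversion_at_0)
    show "integrable lborel q" unfolding q_def
    proof (rule Bochner_Integration.integrable_bound[of _ "normal_density 0 (sqrt ?n)"])
      show "AE s in lborel. norm (normal_density 0 (sqrt ?n) s * ?Q s) \<le> norm (normal_density 0 (sqrt ?n) s)"
        using Q_abs by (auto simp: abs_mult intro!: mult_left_le)
    qed (use n in \<open>auto simp: integrable_normal_density\<close>)
    show "\<bar>q s\<bar> \<le> 1 / sqrt (2 * pi * ?n) * 1" for s
      unfolding q_def abs_mult using n
      by (intro mult_mono) (use nd_le Q_abs in auto)
    show "isCont q 0"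
      unfolding q_def normal_density_def
      by (intro continuous_intros isCont_shifted_deviation_prob I) (use n in auto)
    show "integrable lborel (\<lambda>w. CLBINT s. q s *\<^sub>R iexp (- w * s))"
      unfolding \<psi>[symmetric]
      by (rule integrable_half_char_power) (use I J in \<open>simp add: card_Diff_subset finite_subset card_mono\<close>)
  qed
  then show ?thesis unfolding \<psi>
    using n by (simp add: q_def normal_density_def)
qed

section \<open>Transfer to the given random vector\<close>

lemma distr_std_normal_vector:
  assumes "prob_space M" "m \<ge> 1" "std_normal_vector M m g"
  shows "distr M (PiM {1..m} (\<lambda>_. borel)) (\<lambda>\<omega>. \<lambda>i\<in>{1..m}. g i \<omega>) = std_normal_PiM {1..m}"
proof -
  interpret prob_space M by fact
  have d: "distributed M lborel (g j) (\<lambda>x. ennreal (std_normal_density x))" if "j \<in> {1..m}" for j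
    using assms that by (auto simp: std_normal_vector_def)
  have "distr M (PiM {1..m} (\<lambda>_. borel)) (\<lambda>\<omega>. \<lambda>i\<in>{1..m}. g i \<omega>) = PiM {1..m} (\<lambda>i. distr M borel (g i))"
    using assms by (subst indep_vars_iff_distr_eq_PiM'[symmetric])
      (auto simp: std_normal_vector_def indep_vars_def)
  also have "\<dots> = std_normal_PiM {1..m}"
    unfolding std_normal_PiM_def
  proof (intro PiM_cong refl)
    fix j assume "j \<in> {1..m}"
    then show "distr M borel (g j) = std_normal_distribution"
      using distributed_distr_eq_density[OF d] by (metis distr_cong sets_lborel)
  qed
  finally show ?thesis .
qed

(* The infimum in ereal of a finite nonempty family is its minimum, and that of the empty
   family (k = m) is +\<infinity>.  Integrability is stated because the Bochner integral of a
   non-integrable function is 0 by convention. *)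
theorem corollary3:
  fixes M :: "'a measure" and g :: "nat \<Rightarrow> 'a \<Rightarrow> real" and m k :: nat
  assumes "prob_space M"
    and "m \<ge> 2" and "1 \<le> k" and "k \<le> m"
    and "std_normal_vector M m g"
  shows "integrable M (\<lambda>\<omega>. Phi (\<i> * complex_of_real (g 1 \<omega>) / complex_of_real (sqrt (real m))) ^ k *
             Phi (- \<i> * complex_of_real (g 1 \<omega>) / complex_of_real (sqrt (real m))) ^ (m - k)) \<and>
         complex_of_real (\<P>(\<omega> in M.
             (MAX l\<in>{1..k}. g l \<omega>) \<le> (1 / real m) * (\<Sum>j=1..m. g j \<omega>) \<and>
             ereal ((1 / real m) * (\<Sum>j=1..m. g j \<omega>)) \<le> (INF r\<in>{k+1..m}. ereal (g r \<omega>)))) =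
         (\<integral>\<omega>. Phi (\<i> * complex_of_real (g 1 \<omega>) / complex_of_real (sqrt (real m))) ^ k *
             Phi (- \<i> * complex_of_real (g 1 \<omega>) / complex_of_real (sqrt (real m))) ^ (m - k) \<partial>M)"
proof -
  interpret prob_space M by fact
  let ?I = "{1..m}" and ?J = "{1..k}"
  let ?B = "sign_orthant ?J ?I"
  let ?Q = "shifted_deviation_prob ?I ?B"
  \<comment> \<open>The summand 0 / n is kept so that \<open>?T\<close> matches the body of
    \<open>shifted_deviation_prob\<close> at s = 0.\<close>
  let ?T = "\<lambda>t. \<lambda>j\<in>?I. deviation ?I t j + 0 / real (card ?I)"
  define \<psi> where "\<psi> w = half_char w ^ k * half_char (- w) ^ (m - k)" for w
  define F where "F u = Phi (\<i> * complex_of_real u / complex_of_real (sqrt (real m))) ^ k *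
             Phi (- \<i> * complex_of_real u / complex_of_real (sqrt (real m))) ^ (m - k)" for u
  have card_diff: "card (?I - ?J) = m - k"
    using assms by (simp add: card_Diff_subset)
  have m: "real m > 0" using assms by simp
  have \<psi>_meas[measurable]: "\<psi> \<in> borel_measurable borel"
    unfolding \<psi>_def[abs_def] by measurable
  have F_eq: "F u = of_real (exp (u\<^sup>2 / 2)) * \<psi> (u / sqrt m)" for u
  proof -
    let ?w = "u / sqrt m"
    have "F u = Phi (\<i> * of_real ?w) ^ k * Phi (\<i> * of_real (- ?w)) ^ (m - k)"
      by (simp add: F_def)
    also have "\<dots> = of_real (exp (?w\<^sup>2 / 2)) ^ (k + (m - k)) * \<psi> ?w"
      unfolding Phi_imaginary \<psi>_def by (simp add: power_mult_distrib power_add)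
    also have "exp (?w\<^sup>2 / 2) ^ (k + (m - k)) = exp (u\<^sup>2 / 2)"
      using assms by (simp add: exp_of_nat_mult[symmetric] power_divide)
    then have "complex_of_real (exp (?w\<^sup>2 / 2)) ^ (k + (m - k)) = of_real (exp (u\<^sup>2 / 2))"
      by (metis of_real_power)
    finally show ?thesis .
  qed
  have F_meas[measurable]: "F \<in> borel_measurable borel"
    unfolding F_eq[abs_def] by measurable
  \<comment> \<open>The density of \<open>g 1\<close> cancels the growth exp(u^2 / 2) of
    \<open>F\<close>; the argument has the shape of an affine substitution. Both integrability and
    value now reduce to \<psi>.\<close>
  have \<phi>F: "std_normal_density u *\<^sub>R F u = (1 / sqrt (2 * pi)) *\<^sub>R \<psi> (0 + 1 / sqrt m * u)" for u
    by (simp add: F_eq std_normal_density_def scaleR_conv_of_real exp_minus field_simps flip: of_real_mult)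
  have \<psi>_int: "integrable lborel \<psi>"
    unfolding \<psi>_def[abs_def] using assms by (intro integrable_half_char_power) auto
  have d1: "distributed M lborel (g 1) (\<lambda>x. ennreal (std_normal_density x))"
    using assms by (auto simp: std_normal_vector_def)
  note d1' = distributed_distr_eq_density[OF d1]
  have g1[measurable]: "g 1 \<in> M \<rightarrow>\<^sub>M lborel" using d1 by (rule distributed_measurable)
  have "integrable std_normal_distribution F"
  proof (subst integrable_density)
    show "integrable lborel (\<lambda>u. std_normal_density u *\<^sub>R F u)"
      unfolding \<phi>F using m \<psi>_int by (intro integrable_scaleR_right lborel_integrable_real_affine) auto
  qed auto
  then have int: "integrable M (\<lambda>\<omega>. F (g 1 \<omega>))"
    unfolding d1'[symmetric] by (subst (asm) integrable_distr_eq) (use g1 in auto)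
  have "(LINT \<omega>|M. F (g 1 \<omega>)) = (LINT u|std_normal_distribution. F u)"
    unfolding d1'[symmetric] by (rule integral_distr[OF g1, symmetric]) auto
  also have "\<dots> = (CLBINT u. std_normal_density u *\<^sub>R F u)"
    by (rule integral_density) auto
  also have "\<dots> = (1 / sqrt (2 * pi)) *\<^sub>R (CLBINT u. \<psi> (0 + 1 / sqrt m * u))"
    unfolding \<phi>F by simp
  also have "(CLBINT u. \<psi> (0 + 1 / sqrt m * u)) = sqrt m *\<^sub>R (CLBINT w. \<psi> w)"
    using m by (subst (2) lborel_integral_real_affine[where c="1 / sqrt m" and t=0]) auto
  also have "(CLBINT w. \<psi> w) = of_real (2 * pi / sqrt (2 * pi * m) * ?Q 0)"
    unfolding \<psi>_def using integral_half_char_power[of ?I ?J] assms by (simp add: card_diff[simplified])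
  also have "(1 / sqrt (2 * pi)) *\<^sub>R sqrt m *\<^sub>R of_real (2 * pi / sqrt (2 * pi * m) * ?Q 0) = complex_of_real (?Q 0)"
    using m by (simp add: scaleR_conv_of_real real_sqrt_mult field_simps flip: of_real_mult)
  finally have E: "(LINT \<omega>|M. F (g 1 \<omega>)) = complex_of_real (?Q 0)" .
  let ?A = "{\<omega> \<in> space M. (MAX l\<in>{1..k}. g l \<omega>) \<le> (1 / real m) * (\<Sum>j=1..m. g j \<omega>) \<and>
             ereal ((1 / real m) * (\<Sum>j=1..m. g j \<omega>)) \<le> (INF r\<in>{k+1..m}. ereal (g r \<omega>))}"
  let ?G = "\<lambda>\<omega>. \<lambda>i\<in>?I. g i \<omega>"
  have G[measurable]: "?G \<in> M \<rightarrow>\<^sub>M PiM ?I (\<lambda>_. borel)"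
    using assms by (intro measurable_restrict) (auto simp: std_normal_vector_def indep_vars_def)
  have T[measurable]: "?T \<in> PiM ?I (\<lambda>_. borel) \<rightarrow>\<^sub>M PiM ?I (\<lambda>_. borel)"
    using measurable_compose[OF measurable_Pair1' measurable_shifted_deviation[of ?I], of 0] by simp
  have B[measurable]: "?B \<in> sets (PiM ?I (\<lambda>_. borel))" by (rule sets_sign_orthant) auto
  have A_iff: "\<omega> \<in> ?A \<longleftrightarrow> ?T (?G \<omega>) \<in> ?B" if "\<omega> \<in> space M" for \<omega>
  proof -
    let ?\<mu> = "(1 / real m) * (\<Sum>j=1..m. g j \<omega>)"
    have "(MAX l\<in>{1..k}. g l \<omega>) \<le> ?\<mu> \<longleftrightarrow> (\<forall>l\<in>{1..k}. g l \<omega> \<le> ?\<mu>)"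
      using assms by (subst Max_le_iff) auto
    \<comment> \<open>For k = m the index set is empty, the infimum is \<infinity>, and both sides
      hold trivially.\<close>
    moreover have "ereal ?\<mu> \<le> (INF r\<in>{k+1..m}. ereal (g r \<omega>)) \<longleftrightarrow> (\<forall>r\<in>{k+1..m}. ?\<mu> \<le> g r \<omega>)"
      by (simp add: le_INF_iff)
    moreover have "?T (?G \<omega>) \<in> ?B \<longleftrightarrow> (\<forall>i\<in>?I. if i \<in> ?J then g i \<omega> \<le> ?\<mu> else ?\<mu> \<le> g i \<omega>)"
      by (auto simp: sign_orthant_def deviation_def)
    moreover have "\<dots> \<longleftrightarrow> (\<forall>l\<in>{1..k}. g l \<omega> \<le> ?\<mu>) \<and> (\<forall>r\<in>{k+1..m}. ?\<mu> \<le> g r \<omega>)"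
      using assms by force
    ultimately show ?thesis using that by blast
  qed
  have A_eq: "?A = {\<omega> \<in> space M. ?T (?G \<omega>) \<in> ?B}"
    using A_iff by blast
  have "?Q 0 = (LINT t|distr M (PiM ?I (\<lambda>_. borel)) ?G. indicator ?B (?T t))"
    unfolding shifted_deviation_prob_def using assms by (subst distr_std_normal_vector) auto
  also have "\<dots> = (LINT \<omega>|M. indicator ?B (?T (?G \<omega>)))"
    by (rule integral_distr) measurable
  also have "\<dots> = (LINT \<omega>|M. indicator ?A \<omega>)"
    by (rule Bochner_Integration.integral_cong) (use A_iff in \<open>auto simp: indicator_def\<close>)
  also have "\<dots> = measure M ?A"
    unfolding A_eq by (auto intro!: arg_cong[where f=prob])
  finally have "measure M ?A = ?Q 0" ..
  then show ?thesis using int E unfolding F_def by simp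
qed

end
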